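(* Let $y\colon\mathbb{R}\to\mathbb{R}$ be bounded and uniformly continuous, let $c>0$, let $g(x):=-x-2c\,\dfrac{x}{1+x^2}$ for $x\in\mathbb{R}$, and for each $\lambda\in\mathbb{R}$ consider the equation $$(E_\lambda)\qquad x'=\lambda+y(t)+g(x).$$ If $0<c<4$, then $(E_\lambda)$ exhibits uniform stability for every $\lambda\in\mathbb{R}$; in addition, its hyperbolic solution is positive (i.e. $\ge 0$ on $\mathbb{R}$) if $\lambda\ge-\inf_{r\in\mathbb{R}}y(r)$. Finally, if $c=4$, then, for every $\lambda\in\mathbb{R}$, $(E_\lambda)$ does not have two uniformly separated hyperbolic solutions.
   Context: A bounded solution of a scalar equation is a solution defined on all of $\mathbb{R}$ and bounded. Two bounded solutions $b_1,b_2$ are uniformly separated if $\inf_{t\in\mathbb{R}}|b_1(t)-b_2(t)|>0$. A bounded solution $b$ of $(E_\lambda)$ is hyperbolic attractive (resp. hyperbolic repulsive) if there exist $k\ge1$ and $\gamma>0$ such that $\exp\left(\int_s^t g'(b(r))\,dr\right)\le k\,e^{-\gamma(t-s)}$ whenever $t\ge s$ (resp. $\exp\left(\int_s^t g'(b(r))\,dr\right)\le k\,e^{\gamma(t-s)}$ whenever $t\le s$). A hyperbolic solution is one that is hyperbolic attractive or hyperbolic repulsive. $(E_\lambda)$ exhibits uniform stability if it has exactly one bounded solution and this solution is hyperbolic attractive. "Positive" means $\ge0$ and "strictly positive" means $>0$. *)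

theory Defs
  imports "HOL-Analysis.Analysis"
begin

definition vector_field :: "(real \<Rightarrow> real) \<Rightarrow> (real \<Rightarrow> real) \<Rightarrow> real \<Rightarrow> real \<Rightarrow> real \<Rightarrow> real" where
  "vector_field y g lam t x = lam + y t + g x"

definition bounded_solution :: "(real \<Rightarrow> real \<Rightarrow> real) \<Rightarrow> (real \<Rightarrow> real) \<Rightarrow> bool" where
  "bounded_solution f b \<longleftrightarrow>
     (\<forall>t. (b has_real_derivative f t (b t)) (at t)) \<and> bounded (range b)"

definition uniformly_separated :: "(real \<Rightarrow> real) \<Rightarrow> (real \<Rightarrow> real) \<Rightarrow> bool" where
  "uniformly_separated b\<^sub>1 b\<^sub>2 \<longleftrightarrow> (INF t. \<bar>b\<^sub>1 t - b\<^sub>2 t\<bar>) > 0"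

text \<open>The interval integral below is oriented, i.e. it changes sign when the two
  endpoints are exchanged; the repulsive case, where \<open>t \<le> s\<close>, relies on this.\<close>

definition hyperbolic_attractive ::
  "(real \<Rightarrow> real) \<Rightarrow> (real \<Rightarrow> real) \<Rightarrow> real \<Rightarrow> (real \<Rightarrow> real) \<Rightarrow> bool" where
  "hyperbolic_attractive y g lam b \<longleftrightarrow>
     bounded_solution (vector_field y g lam) b \<and>
     (\<exists>k \<gamma>. k \<ge> 1 \<and> \<gamma> > 0 \<and>
       (\<forall>s t. t \<ge> s \<longrightarrow>
         exp (LBINT r=ereal s..ereal t. deriv g (b r)) \<le> k * exp (- \<gamma> * (t - s))))"

definition hyperbolic_repulsive ::
  "(real \<Rightarrow> real) \<Rightarrow> (real \<Rightarrow> real) \<Rightarrow> real \<Rightarrow> (real \<Rightarrow> real) \<Rightarrow> bool" where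
  "hyperbolic_repulsive y g lam b \<longleftrightarrow>
     bounded_solution (vector_field y g lam) b \<and>
     (\<exists>k \<gamma>. k \<ge> 1 \<and> \<gamma> > 0 \<and>
       (\<forall>s t. t \<le> s \<longrightarrow>
         exp (LBINT r=ereal s..ereal t. deriv g (b r)) \<le> k * exp (\<gamma> * (t - s))))"

definition hyperbolic_solution ::
  "(real \<Rightarrow> real) \<Rightarrow> (real \<Rightarrow> real) \<Rightarrow> real \<Rightarrow> (real \<Rightarrow> real) \<Rightarrow> bool" where
  "hyperbolic_solution y g lam b \<longleftrightarrow> hyperbolic_attractive y g lam b \<or> hyperbolic_repulsive y g lam b"

definition uniform_stability :: "(real \<Rightarrow> real) \<Rightarrow> (real \<Rightarrow> real) \<Rightarrow> real \<Rightarrow> bool" where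
  "uniform_stability y g lam \<longleftrightarrow>
     (\<exists>!b. bounded_solution (vector_field y g lam) b) \<and>
     (\<forall>b. bounded_solution (vector_field y g lam) b \<longrightarrow> hyperbolic_attractive y g lam b)"

definition g_fun :: "real \<Rightarrow> real \<Rightarrow> real" where
  "g_fun c x = - x - 2 * c * (x / (1 + x\<^sup>2))"

end

theory Submission imports Defs begin

text \<open>
  Write \<open>g\<close> for \<open>g_fun c\<close>. Everything rests on the identity
  \<open>g a - g b = - (a - b) (1 + 2 c q)\<close> with
  \<open>q = (1 - a b) / ((1 + a\<^sup>2) (1 + b\<^sup>2))\<close>, together with the sharp bound \<open>q \<ge> - 1/8\<close>, attained at
  \<open>a = b = \<plusminus>\<surd>3\<close>. It is this constant that makes \<open>c = 4\<close> the threshold: \<open>g\<close> is strictly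
  decreasing for \<open>0 \<le> c \<le> 4\<close>, and its slope is at most \<open>c/4 - 1\<close>.

  Uniqueness (\<open>bounded_solution_unique\<close>): the squared distance \<open>w\<close> of two solutions cannot
  increase, so if it is positive at some time it is bounded below at all earlier times. There the
  dissipation is bounded away from zero as well, and \<open>w\<close> would have to grow without bound as
  \<open>t \<rightarrow> -\<infinity>\<close>. The estimate used, with \<open>(a - b)\<^sup>4\<close> on the right-hand side
  (\<open>g_fun_dissipative\<close>), survives at \<open>c = 4\<close>; hence there is then only one bounded solution
  too, and no two bounded solutions are separated, hyperbolic or not.

  Existence (\<open>bounded_solution_exists\<close>): with \<open>L = 1 + 2 c\<close>, which dominates the slope of \<open>-g\<close>,
  the equation reads \<open>x' = - L x + (h + \<phi>(x))\<close> where \<open>h = lam + y\<close> and \<open>\<phi>(x) = g(x) + L x\<close> has Lipschitz constant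
  \<open>9 c / 4 < L\<close> for \<open>c < 4\<close>. Bounded solutions are then the fixed points of a contraction on the
  bounded continuous functions, namely of \<open>x\<close> mapped to the bounded solution of the linear equation
  forced by \<open>h + \<phi>(x)\<close>. For nonnegative \<open>h\<close> this map preserves nonnegative functions, so its fixed
  point is nonnegative.

  The bounded solution is attractive because \<open>deriv g \<le> c/4 - 1 < 0\<close> everywhere
  (\<open>bounded_solution_attractive\<close>).
\<close>

section \<open>The nonlinearity\<close>

lemma g_fun_diff:
  "g_fun c a - g_fun c b =
     - (a - b) * (1 + 2 * c * ((1 - a * b) / ((1 + a\<^sup>2) * (1 + b\<^sup>2))))"
proof -
  have "1 + a\<^sup>2 \<noteq> 0" "1 + b\<^sup>2 \<noteq> 0"
    by (smt (verit) zero_le_power2)+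
  then have "a / (1 + a\<^sup>2) - b / (1 + b\<^sup>2) = (a - b) * ((1 - a * b) / ((1 + a\<^sup>2) * (1 + b\<^sup>2)))"
    by (simp add: divide_simps) (simp add: algebra_simps power2_eq_square)
  moreover have "g_fun c a - g_fun c b = - (a - b) - 2 * c * (a / (1 + a\<^sup>2) - b / (1 + b\<^sup>2))"
    unfolding g_fun_def right_diff_distrib by linarith
  moreover have "- (a - b) - 2 * c * ((a - b) * q) = - (a - b) * (1 + 2 * c * q)" for q
    by (simp add: algebra_simps)
  ultimately show ?thesis
    by (simp only:)
qed

text \<open>Lagrange's identity. It makes \<open>D + 8 (1 - a b)\<close>, for the denominator \<open>D\<close> of \<open>q\<close>, the sum of
  squares \<open>(a b - 3)\<^sup>2 + (a - b)\<^sup>2\<close>; this is where the constant \<open>1/8\<close> comes from.\<close>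

lemma product_one_plus_squares:
  "(1 + a\<^sup>2) * (1 + b\<^sup>2) = (1 + a * b)\<^sup>2 + (a - b)\<^sup>2" for a b :: real
  by (simp add: algebra_simps power2_eq_square)

lemma quotient_bounds:
  fixes a b :: real
  shows "- 1 / 8 \<le> (1 - a * b) / ((1 + a\<^sup>2) * (1 + b\<^sup>2))"
    and "(1 - a * b) / ((1 + a\<^sup>2) * (1 + b\<^sup>2)) \<le> 1"
    and "(a - b)\<^sup>2 / ((1 + a\<^sup>2) * (1 + b\<^sup>2)) \<le> 1 + 8 * ((1 - a * b) / ((1 + a\<^sup>2) * (1 + b\<^sup>2)))"
    and "(a - b)\<^sup>2 / ((1 + a\<^sup>2) * (1 + b\<^sup>2)) \<le> 1"
proof -
  define D where "D = (1 + a\<^sup>2) * (1 + b\<^sup>2)"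
  have D: "D > 0"
    unfolding D_def by (intro mult_pos_pos) (smt (verit) zero_le_power2)+
  have eq: "D = (1 + a * b)\<^sup>2 + (a - b)\<^sup>2"
    unfolding D_def by (rule product_one_plus_squares)
  have sq: "D + 8 * (1 - a * b) = (a * b - 3)\<^sup>2 + (a - b)\<^sup>2"
    unfolding eq by (simp add: algebra_simps power2_eq_square)
  have "1 - a * b \<le> D"
  proof -
    have "D - (1 - a * b) = (a * b)\<^sup>2 + ((a + b)\<^sup>2 + a\<^sup>2 + b\<^sup>2) / 2"
      unfolding D_def by (simp add: algebra_simps power2_eq_square)
    also have "\<dots> \<ge> 0" by simp
    finally show ?thesis by simp
  qed
  then show "(1 - a * b) / ((1 + a\<^sup>2) * (1 + b\<^sup>2)) \<le> 1"
    using D unfolding D_def[symmetric] by simp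
  have "D + 8 * (1 - a * b) \<ge> 0" unfolding sq by simp
  then show "- 1 / 8 \<le> (1 - a * b) / ((1 + a\<^sup>2) * (1 + b\<^sup>2))"
    using D unfolding D_def[symmetric] by (simp add: field_simps)
  have "(a - b)\<^sup>2 \<le> D + 8 * (1 - a * b)" unfolding sq by simp
  then have "(a - b)\<^sup>2 / D \<le> (D + 8 * (1 - a * b)) / D"
    using D by (intro divide_right_mono) auto
  then show "(a - b)\<^sup>2 / ((1 + a\<^sup>2) * (1 + b\<^sup>2))
      \<le> 1 + 8 * ((1 - a * b) / ((1 + a\<^sup>2) * (1 + b\<^sup>2)))"
    using D unfolding D_def[symmetric] by (simp add: add_divide_distrib)
  show "(a - b)\<^sup>2 / ((1 + a\<^sup>2) * (1 + b\<^sup>2)) \<le> 1"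
    using D eq unfolding D_def[symmetric] by simp
qed

text \<open>The factor \<open>1 + 2 c q\<close> is affine in \<open>c\<close>, so it suffices to bound it at \<open>c = 0\<close> and \<open>c = 4\<close>.
  At \<open>c = 4\<close> it vanishes where \<open>a = b = \<plusminus>\<surd>3\<close>, so a bound by a fixed
  multiple of \<open>- (a - b)\<^sup>2\<close> is impossible; a fourth power remains.\<close>

lemma g_fun_dissipative:
  assumes c: "0 \<le> c" "c \<le> 4"
  shows "(a - b) * (g_fun c a - g_fun c b) \<le> - ((a - b)\<^sup>2 * (a - b)\<^sup>2 / ((1 + a\<^sup>2) * (1 + b\<^sup>2)))"
proof -
  define q where "q = (1 - a * b) / ((1 + a\<^sup>2) * (1 + b\<^sup>2))"
  define e where "e = (a - b)\<^sup>2 / ((1 + a\<^sup>2) * (1 + b\<^sup>2))"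
  have e: "e \<le> 1 + 8 * q" "e \<le> 1"
    using quotient_bounds(3,4)[of a b] unfolding q_def e_def by auto
  have "e = (1 - c / 4) * e + c / 4 * e" by (simp add: algebra_simps)
  also have "\<dots> \<le> (1 - c / 4) * 1 + c / 4 * (1 + 8 * q)"
    using c e by (intro add_mono mult_left_mono) auto
  also have "\<dots> = 1 + 2 * c * q" by (simp add: algebra_simps)
  finally have "(a - b)\<^sup>2 * e \<le> (a - b)\<^sup>2 * (1 + 2 * c * q)"
    by (intro mult_left_mono) auto
  moreover have "(a - b) * (g_fun c a - g_fun c b) = - ((a - b)\<^sup>2 * (1 + 2 * c * q))"
    unfolding g_fun_diff q_def[symmetric]
    by (simp only: power2_eq_square mult_minus_left mult_minus_right mult.assoc)
  ultimately show ?thesis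
    unfolding e_def by simp
qed

lemma g_fun_remainder_lipschitz:
  assumes c: "0 \<le> c"
  shows "\<bar>(g_fun c a + (1 + 2 * c) * a) - (g_fun c b + (1 + 2 * c) * b)\<bar> \<le> 9 * c / 4 * \<bar>a - b\<bar>"
proof -
  define q where "q = (1 - a * b) / ((1 + a\<^sup>2) * (1 + b\<^sup>2))"
  have q: "- 1 / 8 \<le> q" "q \<le> 1"
    using quotient_bounds(1,2)[of a b] unfolding q_def by auto
  have "(g_fun c a + (1 + 2 * c) * a) - (g_fun c b + (1 + 2 * c) * b)
      = (g_fun c a - g_fun c b) + (1 + 2 * c) * (a - b)"
    by (simp add: algebra_simps)
  also have "\<dots> = 2 * c * (1 - q) * (a - b)"
    unfolding g_fun_diff q_def[symmetric] by (simp add: algebra_simps)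
  finally have "\<bar>(g_fun c a + (1 + 2 * c) * a) - (g_fun c b + (1 + 2 * c) * b)\<bar>
      = 2 * c * (1 - q) * \<bar>a - b\<bar>"
    using c q by (simp add: abs_mult)
  also have "\<dots> \<le> 2 * c * (9 / 8) * \<bar>a - b\<bar>"
    using c q by (intro mult_right_mono mult_left_mono) auto
  finally show ?thesis by simp
qed

lemma g_fun_remainder_nonneg:
  assumes "0 \<le> c" "0 \<le> x"
  shows "0 \<le> g_fun c x + (1 + 2 * c) * x"
proof -
  have "x / (1 + x\<^sup>2) \<le> x / 1"
    using assms by (intro divide_left_mono) (auto intro: add_pos_nonneg)
  then have "2 * c * (x / (1 + x\<^sup>2)) \<le> 2 * c * x"
    using assms by (intro mult_left_mono) auto
  then show ?thesis
    unfolding g_fun_def by (simp add: algebra_simps)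
qed

lemma g_fun_has_derivative:
  "(g_fun c has_real_derivative - 1 - 2 * c * ((1 - x\<^sup>2) / (1 + x\<^sup>2)\<^sup>2)) (at x)"
proof -
  have "1 + x\<^sup>2 \<noteq> 0"
    by (smt (verit) zero_le_power2)
  then have "((\<lambda>x. - x - 2 * c * (x / (1 + x\<^sup>2))) has_real_derivative
      - 1 - 2 * c * ((1 - x\<^sup>2) / (1 + x\<^sup>2)\<^sup>2)) (at x)"
    by (auto intro!: derivative_eq_intros simp: power2_eq_square algebra_simps)
  then show ?thesis
    unfolding g_fun_def[abs_def] .
qed

lemma deriv_g_fun: "deriv (g_fun c) x = - 1 - 2 * c * ((1 - x\<^sup>2) / (1 + x\<^sup>2)\<^sup>2)"
  by (rule DERIV_imp_deriv) (rule g_fun_has_derivative)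

lemma deriv_g_fun_le:
  assumes "0 \<le> c"
  shows "deriv (g_fun c) x \<le> c / 4 - 1"
proof -
  \<comment> \<open>The diagonal case of the bound on \<open>q\<close>.\<close>
  have "- 1 / 8 \<le> (1 - x\<^sup>2) / (1 + x\<^sup>2)\<^sup>2"
    using quotient_bounds(1)[of x x] by (simp add: power2_eq_square)
  then have "2 * c * (- 1 / 8) \<le> 2 * c * ((1 - x\<^sup>2) / (1 + x\<^sup>2)\<^sup>2)"
    using assms by (intro mult_left_mono) auto
  then show ?thesis
    unfolding deriv_g_fun by simp
qed

section \<open>Uniqueness of the bounded solution\<close>

lemma no_bounded_backward_decrease:
  fixes w :: "real \<Rightarrow> real"
  assumes der: "\<And>t. t \<le> t0 \<Longrightarrow> (w has_real_derivative w' t) (at t)"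
    and le: "\<And>t. t \<le> t0 \<Longrightarrow> w' t \<le> - e"
    and e: "e > 0" and bnd: "\<And>t. w t \<le> B"
  shows False
proof -
  define s where "s = t0 - (\<bar>B - w t0\<bar> + 1) / e"
  have s: "s \<le> t0" and es: "e * (t0 - s) = \<bar>B - w t0\<bar> + 1"
    using e unfolding s_def by auto
  have "w t0 + e * t0 \<le> w s + e * s"
  proof (rule DERIV_nonpos_imp_nonincreasing[OF s])
    fix t assume "s \<le> t" "t \<le> t0"
    then have "((\<lambda>t. w t + e * t) has_real_derivative w' t + e) (at t)"
      by (auto intro!: derivative_eq_intros der)
    with le[of t] \<open>t \<le> t0\<close> show "\<exists>d. ((\<lambda>t. w t + e * t) has_real_derivative d) (at t) \<and> d \<le> 0"
      by (intro exI[of _ "w' t + e"]) auto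
  qed
  then have "w t0 + (\<bar>B - w t0\<bar> + 1) \<le> w s"
    using es by (simp add: algebra_simps)
  with bnd[of s] show False by linarith
qed

lemma bounded_solution_unique:
  assumes c: "0 \<le> c" "c \<le> 4"
    and b1: "bounded_solution (vector_field y (g_fun c) lam) b1"
    and b2: "bounded_solution (vector_field y (g_fun c) lam) b2"
  shows "b1 = b2"
proof (rule ccontr)
  assume "b1 \<noteq> b2"
  then obtain t0 where t0: "b1 t0 \<noteq> b2 t0" by auto
  define w where "w = (\<lambda>t. (b1 t - b2 t)\<^sup>2)"
  define w' where "w' = (\<lambda>t. 2 * ((b1 t - b2 t) * (g_fun c (b1 t) - g_fun c (b2 t))))"
  define d where "d = w t0"
  have der: "(w has_real_derivative w' t) (at t)" for t
  proof -
    have "(b1 has_real_derivative lam + y t + g_fun c (b1 t)) (at t)"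
      "(b2 has_real_derivative lam + y t + g_fun c (b2 t)) (at t)"
      using b1 b2 unfolding bounded_solution_def vector_field_def by auto
    then show ?thesis
      unfolding w_def w'_def
      by (auto intro!: derivative_eq_intros simp: algebra_simps)
  qed
  obtain M1 M2 where M1: "\<And>t. \<bar>b1 t\<bar> \<le> M1" and M2: "\<And>t. \<bar>b2 t\<bar> \<le> M2"
    using b1 b2 unfolding bounded_solution_def bounded_iff by auto
  \<comment> \<open>Boundedness of the solutions keeps the dissipation rate from degenerating at infinity.\<close>
  define K where "K = (1 + M1\<^sup>2) * (1 + M2\<^sup>2)"
  have K: "K > 0"
    unfolding K_def by (intro mult_pos_pos) (smt (verit) zero_le_power2)+
  have diss: "w' t \<le> - (2 * (w t)\<^sup>2 / K)" for t
  proof -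
    let ?D = "(1 + (b1 t)\<^sup>2) * (1 + (b2 t)\<^sup>2)"
    have "(b1 t)\<^sup>2 \<le> M1\<^sup>2" "(b2 t)\<^sup>2 \<le> M2\<^sup>2"
      using M1[of t] M2[of t] by (auto intro: power2_le_iff_abs_le[THEN iffD2] simp: abs_le_square_iff[symmetric])
    then have "?D \<le> K"
      unfolding K_def by (intro mult_mono) auto
    moreover have "?D > 0"
      by (intro mult_pos_pos) (smt (verit) zero_le_power2)+
    ultimately have "(w t)\<^sup>2 / K \<le> (w t)\<^sup>2 / ?D"
      by (intro divide_left_mono) auto
    moreover have "w' t \<le> - (2 * ((w t)\<^sup>2 / ?D))"
      using g_fun_dissipative[OF c, of "b1 t" "b2 t"]
      unfolding w'_def w_def by (simp add: power2_eq_square)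
    ultimately show ?thesis by simp
  qed
  have d: "d > 0" using t0 unfolding d_def w_def by simp
  have mono: "d \<le> w t" if "t \<le> t0" for t
    unfolding d_def
  proof (rule DERIV_nonpos_imp_nonincreasing[OF that])
    fix s
    have "- (2 * (w s)\<^sup>2 / K) \<le> 0" using K by simp
    then have "w' s \<le> 0" using diss[of s] by linarith
    then show "\<exists>z. (w has_real_derivative z) (at s) \<and> z \<le> 0"
      using der by blast
  qed
  show False
  proof (rule no_bounded_backward_decrease[of t0 w w' "2 * d\<^sup>2 / K" "(M1 + M2)\<^sup>2"])
    fix t
    show "(w has_real_derivative w' t) (at t)" by (rule der)
    show "w t \<le> (M1 + M2)\<^sup>2"
      unfolding w_def using M1[of t] M2[of t] by (simp add: abs_le_square_iff[symmetric])
    show "2 * d\<^sup>2 / K > 0" using d K by simp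
    assume "t \<le> t0"
    then have "d\<^sup>2 \<le> (w t)\<^sup>2" using mono d by (intro power_mono) auto
    then have "2 * d\<^sup>2 / K \<le> 2 * (w t)\<^sup>2 / K" using K by (intro divide_right_mono) auto
    then show "w' t \<le> - (2 * d\<^sup>2 / K)" using diss[of t] by linarith
  qed
qed

section \<open>Existence of a bounded solution\<close>

text \<open>The bounded solution of \<open>x' = - L x + h\<close>, by variation of constants from \<open>-\<infinity>\<close>.\<close>

definition linear_response :: "real \<Rightarrow> (real \<Rightarrow> real) \<Rightarrow> real \<Rightarrow> real" where
  "linear_response L h t = exp (- L * t) * integral {..t} (\<lambda>s. exp (L * s) * h s)"

lemma has_integral_exp_from_minus_infinity:
  fixes L t :: real
  assumes "L > 0"
  shows "((\<lambda>s. exp (L * s)) has_integral exp (L * t) / L) {..t}"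
proof -
  let ?f = "\<lambda>s::real. exp (L * s)"
  have i: "((\<lambda>s. ?f (- s)) has_integral exp (L * t) / L) {- t..}"
    using has_integral_exp_minus_to_infinity[OF assms, of "- t"] by simp
  then have "(\<lambda>s. ?f (- s)) absolutely_integrable_on {- t..}"
    by (intro nonnegative_absolutely_integrable_1) (auto simp: has_integral_iff)
  then have "?f absolutely_integrable_on {..t} \<and> integral {..t} ?f = exp (L * t) / L"
    using i by (subst has_absolute_integral_reflect_real[of "{- t..}" "{..t}", symmetric])
      (auto simp: has_integral_iff)
  then show ?thesis
    by (auto simp: has_integral_iff set_lebesgue_integral_eq_integral)
qed

context
  fixes L M :: real and h :: "real \<Rightarrow> real"
  assumes L: "L > 0" and cont: "continuous_on UNIV h" and bnd: "\<And>t. \<bar>h t\<bar> \<le> M"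
begin

lemma weighted_integrable: "(\<lambda>s. exp (L * s) * h s) integrable_on {..t}"
proof (rule set_lebesgue_integral_eq_integral(1),
    rule measurable_bounded_by_integrable_imp_absolutely_integrable[where g = "\<lambda>s. exp (L * s) * M"])
  show "(\<lambda>s. exp (L * s) * h s) \<in> borel_measurable (lebesgue_on {..t})"
    by (intro continuous_imp_measurable_on_sets_lebesgue continuous_intros
        continuous_on_subset[OF cont]) auto
  show "(\<lambda>s. exp (L * s) * M) integrable_on {..t}"
    using has_integral_exp_from_minus_infinity[OF L, of t]
    by (intro integrable_on_mult_left) (auto simp: has_integral_iff)
qed (use bnd in \<open>auto simp: abs_mult intro!: mult_left_mono\<close>)

lemma linear_response_bound: "\<bar>linear_response L h t\<bar> \<le> M / L"
proof -
  have "norm (integral {..t} (\<lambda>s. exp (L * s) * h s)) \<le> integral {..t} (\<lambda>s. exp (L * s) * M)"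
    using has_integral_exp_from_minus_infinity[OF L, of t] bnd
    by (intro integral_norm_bound_integral weighted_integrable integrable_on_mult_left)
      (auto simp: has_integral_iff abs_mult intro!: mult_left_mono)
  also have "\<dots> = exp (L * t) / L * M"
    using has_integral_mult_left[OF has_integral_exp_from_minus_infinity[OF L, of t], of M]
    by (simp add: has_integral_iff)
  finally have "exp (- L * t) * norm (integral {..t} (\<lambda>s. exp (L * s) * h s))
      \<le> exp (- L * t) * (exp (L * t) / L * M)"
    by (intro mult_left_mono) auto
  also have "\<dots> = M / L"
    by (simp flip: exp_add)
  finally show ?thesis
    unfolding linear_response_def by (simp add: abs_mult)
qed

lemma linear_response_nonneg:
  assumes "\<And>t. 0 \<le> h t"
  shows "0 \<le> linear_response L h t"
  unfolding linear_response_def using assms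
  by (intro mult_nonneg_nonneg integral_nonneg weighted_integrable) auto

lemma linear_response_has_derivative:
  "(linear_response L h has_real_derivative h t - L * linear_response L h t) (at t)"
proof -
  let ?f = "\<lambda>s. exp (L * s) * h s"
  let ?a = "t - 1"
  have fc: "continuous_on S ?f" for S
    by (intro continuous_intros continuous_on_subset[OF cont]) auto
  have split: "integral {..u} ?f = integral {..?a} ?f + integral {?a..u} ?f" if "?a < u" for u
  proof -
    have "integral ({..?a} \<union> {?a..u}) ?f = integral {..?a} ?f + integral {?a..u} ?f"
      by (rule integral_Un[OF weighted_integrable integrable_continuous_interval[OF fc]])
        (rule negligible_subset[of "{?a}"], auto)
    moreover have "{..?a} \<union> {?a..u} = {..u}" using that by auto
    ultimately show ?thesis by simp
  qed
  have "((\<lambda>u. integral {?a..u} ?f) has_real_derivative ?f t) (at t within {?a..t + 1})"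
    by (rule integral_has_real_derivative[OF fc]) auto
  then have "((\<lambda>u. integral {?a..u} ?f) has_real_derivative ?f t) (at t)"
    by (simp add: at_within_Icc_at)
  then have "((\<lambda>u. integral {..?a} ?f + integral {?a..u} ?f) has_real_derivative ?f t) (at t)"
    by (auto intro!: derivative_eq_intros)
  then have "((\<lambda>u. integral {..u} ?f) has_real_derivative ?f t) (at t)"
    by (rule has_field_derivative_transform_within_open[where S = "{?a<..}"])
      (auto simp: split)
  then have "((\<lambda>u. exp (- L * u) * integral {..u} ?f) has_real_derivative
      exp (- L * t) * ?f t + - L * exp (- L * t) * integral {..t} ?f) (at t)"
    by (auto intro!: derivative_eq_intros)
  then show ?thesis
    unfolding linear_response_def[abs_def] by (simp flip: exp_add mult.assoc)
qed

end

lemma linear_response_diff_bound: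
  assumes L: "L > 0"
    and h: "continuous_on UNIV h" "\<And>t. \<bar>h t\<bar> \<le> M"
    and k: "continuous_on UNIV k" "\<And>t. \<bar>k t\<bar> \<le> N"
    and d: "\<And>t. \<bar>h t - k t\<bar> \<le> e"
  shows "\<bar>linear_response L h t - linear_response L k t\<bar> \<le> e / L"
proof -
  have "linear_response L h t - linear_response L k t = linear_response L (\<lambda>s. h s - k s) t"
    unfolding linear_response_def
    using integral_diff[OF weighted_integrable[OF L h] weighted_integrable[OF L k], of t]
    by (simp add: right_diff_distrib)
  also have "\<bar>\<dots>\<bar> \<le> e / L"
    by (intro linear_response_bound L d continuous_intros h k)
  finally show ?thesis .
qed

text \<open>The contraction principle, on the closed set of nonnegative functions when \<open>h \<ge> 0\<close>, which
  makes that set invariant, and on the whole space otherwise. Uniqueness transfers the sign to the bounded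
  solution of the equation.\<close>

lemma semilinear_bounded_solution:
  fixes h \<phi> :: "real \<Rightarrow> real"
  assumes h: "continuous_on UNIV h" "bounded (range h)"
    and lip: "\<And>a b. \<bar>\<phi> a - \<phi> b\<bar> \<le> K * \<bar>a - b\<bar>" and K: "0 \<le> K" "K < L"
    and pos: "\<And>x. 0 \<le> x \<Longrightarrow> 0 \<le> \<phi> x"
  obtains b where "\<And>t. (b has_real_derivative h t + \<phi> (b t) - L * b t) (at t)"
    and "bounded (range b)" and "(\<forall>t. 0 \<le> h t) \<longrightarrow> (\<forall>t. 0 \<le> b t)"
proof -
  have L: "L > 0" using K by simp
  define F where "F = (\<lambda>x :: real \<Rightarrow>\<^sub>C real. \<lambda>s. h s + \<phi> (apply_bcontfun x s))"
  have "continuous_on UNIV \<phi>"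
    by (rule lipschitz_on_continuous_on[where L = K, OF lipschitz_onI])
      (use lip K in \<open>auto simp: dist_real_def\<close>)
  then have Fc: "continuous_on UNIV (F x)" for x
    unfolding F_def
    by (intro continuous_on_add h(1)) (auto intro: continuous_on_compose2[of UNIV \<phi>])
  obtain H where H: "\<And>t. \<bar>h t\<bar> \<le> H" using h(2) unfolding bounded_iff by auto
  have "\<exists>M. \<forall>t. \<bar>F x t\<bar> \<le> M" for x
  proof -
    have "\<bar>F x t\<bar> \<le> H + (\<bar>\<phi> 0\<bar> + K * norm x)" for t
    proof -
      have "\<bar>\<phi> (apply_bcontfun x t) - \<phi> 0\<bar> \<le> K * \<bar>apply_bcontfun x t\<bar>"
        using lip[of "apply_bcontfun x t" 0] by simp
      also have "\<dots> \<le> K * norm x"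
        using norm_bounded[of x t] K by (intro mult_left_mono) auto
      finally show ?thesis
        using H[of t] unfolding F_def by linarith
    qed
    then show ?thesis by blast
  qed
  then obtain M where M: "\<And>x t. \<bar>F x t\<bar> \<le> M x" by metis
  note resp = L Fc M
  define T where "T = (\<lambda>x. Bcontfun (linear_response L (F x)))"
  have "linear_response L (F x) \<in> bcontfun" for x
  proof (rule bcontfun_normI)
    show "continuous_on UNIV (linear_response L (F x))"
      using linear_response_has_derivative[OF resp]
      by (meson DERIV_isCont continuous_at_imp_continuous_on)
    show "norm (linear_response L (F x) t) \<le> M x / L" for t
      using linear_response_bound[OF resp] by simp
  qed
  then have T: "apply_bcontfun (T x) = linear_response L (F x)" for x
    unfolding T_def by (simp add: Bcontfun_inverse)
  define A where "A = (if \<forall>t. 0 \<le> h t then {0..} else (UNIV :: real set))"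
  define S where "S = (PiC UNIV (\<lambda>_. A) :: (real \<Rightarrow>\<^sub>C real) set)"
  have S: "x \<in> S \<longleftrightarrow> (\<forall>t. apply_bcontfun x t \<in> A)" for x
    unfolding S_def by (auto simp: mem_PiC_iff)
  have "\<exists>!x. x \<in> S \<and> T x = x"
  proof (rule Banach_fix)
    show "complete S"
      unfolding S_def complete_eq_closed A_def by (intro closed_PiC) auto
    have "0 \<in> S" unfolding S A_def by auto
    then show "S \<noteq> {}" by auto
    show "0 \<le> K / L" "K / L < 1" using K L by auto
    have "T x \<in> S" if "x \<in> S" for x
    proof (cases "\<forall>t. 0 \<le> h t")
      case True
      then have "0 \<le> F x t" for t
        using that pos unfolding F_def S A_def by auto
      then show ?thesis
        using linear_response_nonneg[OF resp] True unfolding S T A_def by auto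
    qed (auto simp: S A_def)
    then show "T ` S \<subseteq> S" by blast
    show "dist (T x) (T z) \<le> K / L * dist x z" if "x \<in> S" "z \<in> S" for x z
    proof (rule dist_bound)
      fix t
      have "\<bar>F x s - F z s\<bar> \<le> K * dist x z" for s
      proof -
        have "\<bar>F x s - F z s\<bar> \<le> K * \<bar>apply_bcontfun x s - apply_bcontfun z s\<bar>"
          using lip unfolding F_def by simp
        also have "\<dots> \<le> K * dist x z"
          using dist_bounded[of x s z] K by (intro mult_left_mono) (auto simp: dist_real_def)
        finally show ?thesis .
      qed
      then have "\<bar>linear_response L (F x) t - linear_response L (F z) t\<bar> \<le> K * dist x z / L"
        by (rule linear_response_diff_bound[OF L Fc M Fc M])
      then show "dist (apply_bcontfun (T x) t) (apply_bcontfun (T z) t) \<le> K / L * dist x z"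
        unfolding T dist_real_def by simp
    qed
  qed
  then obtain x where x: "x \<in> S" "T x = x" by auto
  have eq: "linear_response L (F x) = apply_bcontfun x" using T[of x] x(2) by simp
  show thesis
  proof (rule that)
    show "(apply_bcontfun x has_real_derivative
        h t + \<phi> (apply_bcontfun x t) - L * apply_bcontfun x t) (at t)" for t
      using linear_response_has_derivative[OF resp, of x t] unfolding eq by (simp add: F_def)
    show "bounded (range (apply_bcontfun x))"
      using apply_bcontfun[of x] unfolding bcontfun_def by simp
    show "(\<forall>t. 0 \<le> h t) \<longrightarrow> (\<forall>t. 0 \<le> apply_bcontfun x t)"
      using x(1) unfolding S A_def by auto
  qed
qed

lemma bounded_solution_exists:
  assumes c: "0 \<le> c" "c < 4"
    and y: "continuous_on UNIV y" "bounded (range y)"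
  obtains b where "bounded_solution (vector_field y (g_fun c) lam) b"
    and "(\<forall>t. 0 \<le> lam + y t) \<longrightarrow> (\<forall>t. 0 \<le> b t)"
proof -
  have h: "continuous_on UNIV (\<lambda>t. lam + y t)" "bounded (range (\<lambda>t. lam + y t))"
    using bounded_translation[OF y(2), of lam]
    by (auto intro!: continuous_intros y(1) simp: image_image)
  have "0 \<le> 9 * c / 4" "9 * c / 4 < 1 + 2 * c" using c by auto
  then obtain b where
    b: "\<And>t. (b has_real_derivative
        lam + y t + (g_fun c (b t) + (1 + 2 * c) * b t) - (1 + 2 * c) * b t) (at t)"
      "bounded (range b)" "(\<forall>t. 0 \<le> lam + y t) \<longrightarrow> (\<forall>t. 0 \<le> b t)"
    using semilinear_bounded_solution[OF h g_fun_remainder_lipschitz[OF c(1)] _ _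
        g_fun_remainder_nonneg[OF c(1)]] by blast
  have "bounded_solution (vector_field y (g_fun c) lam) b"
    using b(1,2) unfolding bounded_solution_def vector_field_def by (simp add: add.assoc)
  then show thesis using b(3) that by blast
qed

section \<open>Hyperbolicity\<close>

lemma bounded_solution_attractive:
  assumes c: "0 \<le> c" "c < 4"
    and b: "bounded_solution (vector_field y (g_fun c) lam) b"
  shows "hyperbolic_attractive y (g_fun c) lam b"
proof -
  have bc: "continuous_on UNIV b"
    using b unfolding bounded_solution_def
    by (meson DERIV_isCont continuous_at_imp_continuous_on)
  have nz: "1 + (x::real)\<^sup>2 \<noteq> 0" for x by (smt (verit) zero_le_power2)
  have dc: "continuous_on S (\<lambda>r. deriv (g_fun c) (b r))" for S
    unfolding deriv_g_fun
    by (intro continuous_intros continuous_on_subset[OF bc]) (auto simp: nz)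
  have "exp (LBINT r=ereal s..ereal t. deriv (g_fun c) (b r)) \<le> 1 * exp (- (1 - c / 4) * (t - s))"
    if st: "s \<le> t" for s t
  proof -
    have "(LBINT r=ereal s..ereal t. deriv (g_fun c) (b r))
        = integral {s..t} (\<lambda>r. deriv (g_fun c) (b r))"
      using st by (intro interval_integral_eq_integral borel_integrable_atLeastAtMost' dc) auto
    also have "\<dots> \<le> integral {s..t} (\<lambda>r. c / 4 - 1)"
      using deriv_g_fun_le[OF c(1)]
      by (intro integral_le integrable_continuous_interval dc continuous_intros) auto
    also have "\<dots> = - (1 - c / 4) * (t - s)"
      using st by (simp add: algebra_simps)
    finally show ?thesis by simp
  qed
  moreover have "0 < 1 - c / 4" using c by simp
  ultimately show ?thesis
    using b unfolding hyperbolic_attractive_def by (meson order_refl)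
qed

theorem mainTheorem1:
  fixes y :: "real \<Rightarrow> real" and c :: real
  assumes "bounded (range y)"
    and "uniformly_continuous_on UNIV y"
    and "c > 0"
  shows "(0 < c \<and> c < 4 \<longrightarrow>
           (\<forall>lam. uniform_stability y (g_fun c) lam \<and>
             (lam \<ge> - (INF r. y r) \<longrightarrow>
               (\<forall>b. hyperbolic_solution y (g_fun c) lam b \<longrightarrow> (\<forall>t. b t \<ge> 0))))) \<and>
         (c = 4 \<longrightarrow>
           (\<forall>lam. \<not> (\<exists>b\<^sub>1 b\<^sub>2. hyperbolic_solution y (g_fun c) lam b\<^sub>1 \<and>
                         hyperbolic_solution y (g_fun c) lam b\<^sub>2 \<and>
                         uniformly_separated b\<^sub>1 b\<^sub>2)))"
proof -
  have y: "continuous_on UNIV y"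
    using assms(2) by (rule uniformly_continuous_imp_continuous)
  show ?thesis
  proof (intro conjI impI allI notI)
    fix lam :: real
    assume c: "0 < c \<and> c < 4"
    then show "uniform_stability y (g_fun c) lam"
      using bounded_solution_exists[OF _ _ y assms(1)] bounded_solution_unique[of c y lam]
        bounded_solution_attractive[of c y lam]
      unfolding uniform_stability_def by (metis less_imp_le)
  next
    fix lam t :: real and b
    assume c: "0 < c \<and> c < 4" and lam: "- (INF r. y r) \<le> lam"
      and "hyperbolic_solution y (g_fun c) lam b"
    then have b: "bounded_solution (vector_field y (g_fun c) lam) b"
      unfolding hyperbolic_solution_def hyperbolic_attractive_def hyperbolic_repulsive_def by blast
    have "0 \<le> lam + y s" for s
      using cINF_lower[of y UNIV s] bounded_imp_bdd_below[OF assms(1)] lam by simp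
    then obtain b' where "bounded_solution (vector_field y (g_fun c) lam) b'" and "0 \<le> b' t"
      using bounded_solution_exists[OF _ _ y assms(1), of c lam] c by (metis less_imp_le)
    with b c show "0 \<le> b t"
      using bounded_solution_unique[of c y lam b b'] by simp
  next
    fix lam :: real
    assume c: "c = 4"
      and "\<exists>b\<^sub>1 b\<^sub>2. hyperbolic_solution y (g_fun c) lam b\<^sub>1 \<and>
            hyperbolic_solution y (g_fun c) lam b\<^sub>2 \<and> uniformly_separated b\<^sub>1 b\<^sub>2"
    then obtain b1 b2 where b: "hyperbolic_solution y (g_fun c) lam b1"
        "hyperbolic_solution y (g_fun c) lam b2" and sep: "uniformly_separated b1 b2"
      by blast
    have "b1 = b2"
      using b c unfolding hyperbolic_solution_def hyperbolic_attractive_def hyperbolic_repulsive_def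
      by (intro bounded_solution_unique[of c y lam]) auto
    with sep show False
      unfolding uniformly_separated_def by simp
  qed
qed

end
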